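(* Let $T>0$ and let $X=(X_t)_{t\in[0,T]}$ be a real-valued pathwise continuous Markov process defined on a probability space $(\Omega,\mathcal{A},\mathbb{P})$ with transition operators $(P_{s,t})_{0\le s\le t\le T}$ satisfying the monotony preserving property. Then $X$ satisfies a functional co-monotony principle on its path space $\mathcal{C}([0,T],\mathbb{R})$.
   Context: A probability transition $(P(x,dy))_{x\in\mathbb{R}}$ on $(\mathbb{R},\mathcal{B}or(\mathbb{R}))$ is monotony preserving if, for every bounded or nonnegative monotone function $f:\mathbb{R}\to\mathbb{R}$, the function $Pf(x)=\int f(y)P(x,dy)$ is monotone with the same monotony as $f$. Here $P_{s,t}(x,dy)=\mathbb{P}(X_t\in dy\,|\,X_s=x)$. $\mathcal{C}([0,T],\mathbb{R})$ is equipped with the sup-norm, its Borel $\sigma$-field, and the pointwise order: $\alpha\le\beta$ if $\alpha(t)\le\beta(t)$ for all $t\in[0,T]$. Two measurable functionals $F,G$ on this space are co-monotone if they are both non-decreasing or both non-increasing for this order. $F$ is $\mathbb{P}_X$-a.s. continuous if it is sup-norm continuous at every point of a set of probability $1$ under the distribution $\mathbb{P}_X$ of $X$. $X$ satisfies a functional co-monotony principle on $\mathcal{C}([0,T],\mathbb{R})$ if, for every pair of bounded, co-monotone, $\mathbb{P}_X$-a.s. continuous, measurable functionals $F,G:\mathcal{C}([0,T],\mathbb{R})\to\mathbb{R}$, $\mathbb{E}\,F(X)G(X)\ge\mathbb{E}\,F(X)\,\mathbb{E}\,G(X)$. *)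

theory Defs
  imports "HOL-Probability.Probability" "HOL-Analysis.Urysohn"
begin

section \<open>Monotony preserving transitions\<close>

text \<open>
  A probability transition on the real line is a Markov kernel
  \<open>K \<in> borel \<rightarrow>\<^sub>M prob_algebra borel\<close>. For nonnegative, possibly unbounded \<open>f\<close>, the function
  \<open>K f\<close> takes values in \<open>[0, \<infinity>]\<close>; the Bochner integral would return \<open>0\<close> instead of \<open>\<infinity>\<close>,
  so this case is stated with the nonnegative integral. Monotone real functions are
  automatically Borel measurable.
\<close>

definition monotony_preserving :: "(real \<Rightarrow> real measure) \<Rightarrow> bool" where
  "monotony_preserving K \<longleftrightarrow>
     (\<forall>f :: real \<Rightarrow> real. bounded (range f) \<longrightarrow>
        (mono f \<longrightarrow> mono (\<lambda>x. \<integral>y. f y \<partial>K x)) \<and>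
        (antimono f \<longrightarrow> antimono (\<lambda>x. \<integral>y. f y \<partial>K x))) \<and>
     (\<forall>f :: real \<Rightarrow> real. (\<forall>y. 0 \<le> f y) \<longrightarrow>
        (mono f \<longrightarrow> mono (\<lambda>x. \<integral>\<^sup>+y. ennreal (f y) \<partial>K x)) \<and>
        (antimono f \<longrightarrow> antimono (\<lambda>x. \<integral>\<^sup>+y. ennreal (f y) \<partial>K x)))"


section \<open>Markov processes on \<open>[0, T]\<close>\<close>

definition natural_filtration ::
  "'a measure \<Rightarrow> (real \<Rightarrow> 'a \<Rightarrow> real) \<Rightarrow> real \<Rightarrow> 'a measure" where
  "natural_filtration M X s =
     sigma (space M) {X u -` B \<inter> space M | u B. u \<in> {0..s} \<and> B \<in> sets borel}"

text \<open>
  The Markov property is taken with respect to the natural filtration; it follows from the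
  Markov property with respect to any other filtration to which the process is adapted.
  The last clause says \<open>\<P>(X\<^sub>t \<in> B | X\<^sub>u, u \<le> s) = P\<^sub>s\<^sub>,\<^sub>t(X\<^sub>s, B)\<close> almost surely; in particular
  \<open>P s t x\<close> is a version of the conditional law of \<open>X\<^sub>t\<close> given \<open>X\<^sub>s = x\<close>.
  Only the values of \<open>X\<close> and \<open>P\<close> at times in \<open>[0, T]\<close> matter.
\<close>

definition markov_process ::
  "'a measure \<Rightarrow> real \<Rightarrow> (real \<Rightarrow> 'a \<Rightarrow> real) \<Rightarrow> (real \<Rightarrow> real \<Rightarrow> real \<Rightarrow> real measure) \<Rightarrow> bool" where
  "markov_process M T X P \<longleftrightarrow>
     (\<forall>t\<in>{0..T}. X t \<in> borel_measurable M) \<and>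
     (\<forall>s t. 0 \<le> s \<and> s \<le> t \<and> t \<le> T \<longrightarrow>
        P s t \<in> borel \<rightarrow>\<^sub>M prob_algebra borel \<and>
        (\<forall>B \<in> sets borel.
           AE \<omega> in M. real_cond_exp M (natural_filtration M X s) (\<lambda>\<omega>'. indicator B (X t \<omega>')) \<omega>
                       = measure (P s t (X s \<omega>)) B))"


section \<open>The path space \<open>C([0, T], \<real>)\<close>\<close>

text \<open>
  Paths are functions on the reals that are \<open>undefined\<close> off \<open>[0, T]\<close>
  (cf. \<^const>\<open>extensional\<close>); the metric of \<^const>\<open>cfunspace\<close> is the sup-distance.
\<close>

abbreviation path_metric :: "real \<Rightarrow> (real \<Rightarrow> real) metric" where
  "path_metric T \<equiv> cfunspace (top_of_set {0..T}) euclidean_metric"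

abbreviation path_space :: "real \<Rightarrow> (real \<Rightarrow> real) set" where
  "path_space T \<equiv> mspace (path_metric T)"

abbreviation path_topology :: "real \<Rightarrow> (real \<Rightarrow> real) topology" where
  "path_topology T \<equiv> mtopology_of (path_metric T)"

definition path_borel :: "real \<Rightarrow> (real \<Rightarrow> real) measure" where
  "path_borel T = sigma (path_space T) {U. openin (path_topology T) U}"

definition path_le :: "real \<Rightarrow> (real \<Rightarrow> real) \<Rightarrow> (real \<Rightarrow> real) \<Rightarrow> bool" where
  "path_le T \<alpha> \<beta> \<longleftrightarrow> (\<forall>t\<in>{0..T}. \<alpha> t \<le> \<beta> t)"

definition co_monotone ::
  "real \<Rightarrow> ((real \<Rightarrow> real) \<Rightarrow> real) \<Rightarrow> ((real \<Rightarrow> real) \<Rightarrow> real) \<Rightarrow> bool" where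
  "co_monotone T F G \<longleftrightarrow>
     (monotone_on (path_space T) (path_le T) (\<le>) F \<and> monotone_on (path_space T) (path_le T) (\<le>) G) \<or>
     (monotone_on (path_space T) (path_le T) (\<ge>) F \<and> monotone_on (path_space T) (path_le T) (\<ge>) G)"


section \<open>Functional co-monotony principle\<close>

definition sample_path :: "real \<Rightarrow> (real \<Rightarrow> 'a \<Rightarrow> real) \<Rightarrow> 'a \<Rightarrow> (real \<Rightarrow> real)" where
  "sample_path T X \<omega> = restrict (\<lambda>t. X t \<omega>) {0..T}"

definition path_law :: "'a measure \<Rightarrow> real \<Rightarrow> (real \<Rightarrow> 'a \<Rightarrow> real) \<Rightarrow> (real \<Rightarrow> real) measure" where
  "path_law M T X = distr M (path_borel T) (sample_path T X)"

definition as_continuous ::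
  "'a measure \<Rightarrow> real \<Rightarrow> (real \<Rightarrow> 'a \<Rightarrow> real) \<Rightarrow> ((real \<Rightarrow> real) \<Rightarrow> real) \<Rightarrow> bool" where
  "as_continuous M T X F \<longleftrightarrow>
     (\<exists>A \<in> sets (path_borel T). measure (path_law M T X) A = 1 \<and>
        (\<forall>\<alpha>\<in>A. topcontinuous_at (path_topology T) euclidean F \<alpha>))"

definition functional_comonotony_principle ::
  "'a measure \<Rightarrow> real \<Rightarrow> (real \<Rightarrow> 'a \<Rightarrow> real) \<Rightarrow> bool" where
  "functional_comonotony_principle M T X \<longleftrightarrow>
     (\<forall>F G. F \<in> borel_measurable (path_borel T) \<and> G \<in> borel_measurable (path_borel T) \<and>
        bounded (F ` path_space T) \<and> bounded (G ` path_space T) \<and>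
        co_monotone T F G \<and> as_continuous M T X F \<and> as_continuous M T X G \<longrightarrow>
        (\<integral>\<omega>. F (sample_path T X \<omega>) * G (sample_path T X \<omega>) \<partial>M)
          \<ge> (\<integral>\<omega>. F (sample_path T X \<omega>) \<partial>M) * (\<integral>\<omega>. G (sample_path T X \<omega>) \<partial>M))"

end

theory Submission
  imports Defs
begin

text \<open>
  For finitely many times \<open>t\<^sub>0 \<le> \<dots> \<le> t\<^sub>n\<close> one integrates out the last coordinate: given the
  past, two functions that are monotone in \<open>X\<close> at time \<open>t\<^sub>n\<close> are positively correlated (one-dimensional
  Chebyshev inequality), and by the monotony preserving property the conditional expectations are
  again monotone functions of the earlier coordinates, so induction applies. The Bernstein
  operator, which turns sampled values into a path, is linear and positive, hence continuous
  and order preserving, and the Bernstein paths of \<open>X\<close> converge uniformly to \<open>X\<close>.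
  Almost sure continuity of the functionals and dominated convergence then carry the
  finite-dimensional inequality to path space.

  Since the path metric does not live on a type, the functionals are transported to the normed
  space of bounded continuous functions on the real line along the 1-Lipschitz restriction map.
\<close>

section \<open>Chebyshev's association inequality in one variable\<close>

text \<open>Integrating the nonnegative product of increments over two independent copies gives
  twice the covariance. Iterated integrals over \<open>M\<close> stand in for the product measure,
  so linearity is enough. Co-monotony is expressed by the sign of the product, which requires no
  order on the underlying space.\<close>

lemma (in prob_space) integral_mult_ge_of_comonotone:
  fixes f g :: "'a \<Rightarrow> real"
  assumes [measurable]: "f \<in> borel_measurable M" "g \<in> borel_measurable M"
    and f: "\<And>x. \<bar>f x\<bar> \<le> c" and g: "\<And>x. \<bar>g x\<bar> \<le> c"
    and co: "\<And>x y. 0 \<le> (f x - f y) * (g x - g y)"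
  shows "(\<integral>x. f x \<partial>M) * (\<integral>x. g x \<partial>M) \<le> (\<integral>x. f x * g x \<partial>M)"
proof -
  have [simp]: "integrable M f" "integrable M g"
    by (auto intro!: integrable_const_bound[where B=c] simp: f g)
  have [simp]: "integrable M (\<lambda>x. f x * g x)"
    using f g by (intro integrable_const_bound[where B="c * c"])
      (auto simp: abs_mult intro!: mult_mono order_trans[OF abs_ge_zero f])
  let ?f = "\<integral>x. f x \<partial>M" and ?g = "\<integral>x. g x \<partial>M" and ?fg = "\<integral>x. f x * g x \<partial>M"
  have inner: "(\<integral>y. (f x - f y) * (g x - g y) \<partial>M) = f x * g x - f x * ?g - ?f * g x + ?fg" for x
  proof -
    have "(\<integral>y. (f x - f y) * (g x - g y) \<partial>M) = (\<integral>y. f x * g x - f x * g y - f y * g x + f y * g y \<partial>M)"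
      by (simp add: algebra_simps)
    also have "\<dots> = f x * g x - f x * ?g - ?f * g x + ?fg"
      by (simp add: prob_space)
    finally show ?thesis .
  qed
  have "0 \<le> (\<integral>x. (\<integral>y. (f x - f y) * (g x - g y) \<partial>M) \<partial>M)"
    by (intro integral_nonneg_AE AE_I2 co)
  also have "\<dots> = 2 * (?fg - ?f * ?g)"
    unfolding inner by (simp add: prob_space)
  finally show ?thesis by simp
qed

section \<open>Integration against a conditional kernel\<close>

text \<open>The joint law of \<open>(Z, Y)\<close> is the mixture \<open>M \<bind> L\<close>: on a
  rectangle both sides reduce to the integral of
  \<open>indicator A (Z \<omega>) * measure (K \<omega>) B\<close>, and rectangles form an
  intersection-stable generator. Thus the \<open>F\<close>-measurable \<open>Z\<close> may be frozen
  while \<open>Y\<close> is integrated under its conditional law.\<close>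

lemma (in prob_space) nn_integral_cond_kernel:
  fixes Y :: "'a \<Rightarrow> real" and K :: "'a \<Rightarrow> real measure"
  assumes sub: "subalgebra M F"
    and Z: "Z \<in> F \<rightarrow>\<^sub>M N"
    and Y[measurable]: "Y \<in> borel_measurable M"
    and K[measurable]: "K \<in> M \<rightarrow>\<^sub>M prob_algebra borel"
    and cond: "\<And>B. B \<in> sets borel \<Longrightarrow>
      AE \<omega> in M. real_cond_exp M F (\<lambda>\<omega>. indicator B (Y \<omega>)) \<omega> = measure (K \<omega>) B"
    and f[measurable]: "f \<in> borel_measurable (N \<Otimes>\<^sub>M borel)"
  shows "(\<integral>\<^sup>+\<omega>. f (Z \<omega>, Y \<omega>) \<partial>M) = (\<integral>\<^sup>+\<omega>. \<integral>\<^sup>+y. f (Z \<omega>, y) \<partial>K \<omega> \<partial>M)"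
proof -
  interpret S: finite_measure_subalgebra M F by unfold_locales (rule sub)
  have Z_M[measurable]: "Z \<in> M \<rightarrow>\<^sub>M N" by (rule measurable_from_subalg[OF sub Z])
  \<comment> \<open>\<open>L \<omega>\<close> is the product of the Dirac mass at
    \<open>Z \<omega>\<close> with \<open>K \<omega>\<close>, written as an image measure.\<close>
  define L where "L \<omega> = distr (K \<omega>) (N \<Otimes>\<^sub>M borel) (\<lambda>y. (Z \<omega>, y))" for \<omega>
  have L[measurable]: "L \<in> M \<rightarrow>\<^sub>M prob_algebra (N \<Otimes>\<^sub>M borel)"
    unfolding L_def by measurable
  have M_alg: "M \<in> space (prob_algebra M)"
    by (simp add: space_prob_algebra prob_space_axioms)
  have setsK: "sets (K \<omega>) = sets borel" and probK: "prob_space (K \<omega>)" if "\<omega> \<in> space M" for \<omega>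
    using measurable_space[OF K that] by (auto simp: space_prob_algebra)
  have pairZ: "(\<lambda>y. (Z \<omega>, y)) \<in> K \<omega> \<rightarrow>\<^sub>M N \<Otimes>\<^sub>M borel" if "\<omega> \<in> space M" for \<omega>
    using measurable_Pair1'[OF measurable_space[OF Z_M that]] measurable_cong_sets[OF setsK[OF that] refl]
    by blast
  have "distr M (N \<Otimes>\<^sub>M borel) (\<lambda>\<omega>. (Z \<omega>, Y \<omega>)) = M \<bind> L"
  proof (rule measure_eqI_generator_eq[where \<Omega>="space (N \<Otimes>\<^sub>M (borel :: real measure))"
        and E="{a \<times> b |a b. a \<in> sets N \<and> b \<in> sets (borel :: real measure)}"
        and A="\<lambda>_. space (N \<Otimes>\<^sub>M (borel :: real measure))"])
    show "Int_stable {a \<times> b |a b. a \<in> sets N \<and> b \<in> sets (borel :: real measure)}"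
      by (rule Int_stable_pair_measure_generator)
    show "{a \<times> b |a b. a \<in> sets N \<and> b \<in> sets borel} \<subseteq> Pow (space (N \<Otimes>\<^sub>M (borel :: real measure)))"
      using pair_measure_closed[of N borel] by (simp add: space_pair_measure)
    show "sets (distr M (N \<Otimes>\<^sub>M borel) (\<lambda>\<omega>. (Z \<omega>, Y \<omega>))) =
        sigma_sets (space (N \<Otimes>\<^sub>M (borel :: real measure))) {a \<times> b |a b. a \<in> sets N \<and> b \<in> sets (borel :: real measure)}"
      unfolding sets_distr sets_pair_measure space_pair_measure ..
    show "sets (M \<bind> L) =
        sigma_sets (space (N \<Otimes>\<^sub>M (borel :: real measure))) {a \<times> b |a b. a \<in> sets N \<and> b \<in> sets (borel :: real measure)}"
      unfolding sets_bind'[OF M_alg L] sets_pair_measure space_pair_measure ..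
    \<comment> \<open>The measures are finite, so the constant sequence of the whole space, itself a
      rectangle, serves as the exhausting sequence.\<close>
    show "range (\<lambda>_::nat. space (N \<Otimes>\<^sub>M (borel :: real measure))) \<subseteq> {a \<times> b |a b. a \<in> sets N \<and> b \<in> sets borel}"
      unfolding space_pair_measure by blast
    interpret D: prob_space "distr M (N \<Otimes>\<^sub>M borel) (\<lambda>\<omega>. (Z \<omega>, Y \<omega>))"
      by (rule prob_space_distr) measurable
    show "emeasure (distr M (N \<Otimes>\<^sub>M borel) (\<lambda>\<omega>. (Z \<omega>, Y \<omega>))) (space (N \<Otimes>\<^sub>M borel)) \<noteq> \<infinity>"
      by (simp add: D.emeasure_eq_measure)
    fix C assume "C \<in> {a \<times> b |a b. a \<in> sets N \<and> b \<in> sets (borel :: real measure)}"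
    then obtain A B where C: "C = A \<times> B" and A[measurable]: "A \<in> sets N" and B[measurable]: "B \<in> sets borel"
      by auto
    let ?B = "\<lambda>\<omega>. indicator B (Y \<omega>) :: real"
    have A_F: "(\<lambda>\<omega>. indicator A (Z \<omega>) :: real) \<in> borel_measurable F"
      using Z by measurable
    have int: "integrable M (\<lambda>\<omega>. indicator A (Z \<omega>) * ?B \<omega>)"
      by (intro integrable_const_bound[where B=1]) (auto split: split_indicator)
    have mK: "(\<lambda>\<omega>. measure (K \<omega>) B) \<in> borel_measurable M"
      by (rule measurable_compose[OF measurable_prob_algebraD[OF K]]) simp
    have intK: "integrable M (\<lambda>\<omega>. indicator A (Z \<omega>) * measure (K \<omega>) B)"
      using mK probK
      by (intro integrable_const_bound[where B=1])
         (auto intro!: AE_I2 prob_space.prob_le_1 split: split_indicator)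
    have "emeasure (distr M (N \<Otimes>\<^sub>M borel) (\<lambda>\<omega>. (Z \<omega>, Y \<omega>))) C
        = (\<integral>\<^sup>+\<omega>. indicator C (Z \<omega>, Y \<omega>) \<partial>M)"
      by (subst nn_integral_distr[symmetric, where M'="N \<Otimes>\<^sub>M borel"]) (auto simp: C)
    also have "\<dots> = (\<integral>\<^sup>+\<omega>. ennreal (indicator A (Z \<omega>) * ?B \<omega>) \<partial>M)"
      by (intro nn_integral_cong) (auto simp: C split: split_indicator)
    also have "\<dots> = ennreal (\<integral>\<omega>. indicator A (Z \<omega>) * ?B \<omega> \<partial>M)"
      by (rule nn_integral_eq_integral[OF int]) simp
    \<comment> \<open>Since \<open>indicator A (Z \<omega>)\<close> is \<open>F\<close>-measurable,
      the other factor may be replaced by its conditional expectation; \<open>cond\<close> then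
      identifies that with the kernel.\<close>
    also have "(\<integral>\<omega>. indicator A (Z \<omega>) * ?B \<omega> \<partial>M) = (\<integral>\<omega>. indicator A (Z \<omega>) * real_cond_exp M F ?B \<omega> \<partial>M)"
      by (rule S.real_cond_exp_intg(2)[symmetric, OF int A_F]) measurable
    also have "\<dots> = (\<integral>\<omega>. indicator A (Z \<omega>) * measure (K \<omega>) B \<partial>M)"
      using cond[OF B] mK by (intro integral_cong_AE) auto
    also have "ennreal \<dots> = (\<integral>\<^sup>+\<omega>. ennreal (indicator A (Z \<omega>) * measure (K \<omega>) B) \<partial>M)"
      by (rule nn_integral_eq_integral[symmetric, OF intK]) simp
    also have "\<dots> = (\<integral>\<^sup>+\<omega>. emeasure (L \<omega>) C \<partial>M)"
    proof (rule nn_integral_cong)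
      fix \<omega> assume \<omega>: "\<omega> \<in> space M"
      interpret K: prob_space "K \<omega>" by (rule probK[OF \<omega>])
      have "emeasure (L \<omega>) C = emeasure (K \<omega>) ((\<lambda>y. (Z \<omega>, y)) -` C \<inter> space (K \<omega>))"
        unfolding L_def by (rule emeasure_distr[OF pairZ[OF \<omega>]]) (simp add: C)
      also have "(\<lambda>y. (Z \<omega>, y)) -` C \<inter> space (K \<omega>) = (if Z \<omega> \<in> A then B else {})"
        using sets_eq_imp_space_eq[OF setsK[OF \<omega>]] by (auto simp: C)
      finally show "ennreal (indicator A (Z \<omega>) * measure (K \<omega>) B) = emeasure (L \<omega>) C"
        by (auto simp: K.emeasure_eq_measure)
    qed
    also have "\<dots> = emeasure (M \<bind> L) C"
      by (rule emeasure_bind_prob_algebra[OF M_alg L, symmetric]) (simp add: C)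
    finally show "emeasure (distr M (N \<Otimes>\<^sub>M borel) (\<lambda>\<omega>. (Z \<omega>, Y \<omega>))) C = emeasure (M \<bind> L) C" .
  qed auto
  moreover have "(\<integral>\<^sup>+\<omega>. f (Z \<omega>, Y \<omega>) \<partial>M)
      = (\<integral>\<^sup>+p. f p \<partial>distr M (N \<Otimes>\<^sub>M borel) (\<lambda>\<omega>. (Z \<omega>, Y \<omega>)))"
    by (rule nn_integral_distr[symmetric]) measurable
  ultimately have "(\<integral>\<^sup>+\<omega>. f (Z \<omega>, Y \<omega>) \<partial>M) = (\<integral>\<^sup>+p. f p \<partial>(M \<bind> L))"
    by simp
  also have "\<dots> = (\<integral>\<^sup>+\<omega>. \<integral>\<^sup>+p. f p \<partial>L \<omega> \<partial>M)"
    by (rule nn_integral_bind[OF f measurable_prob_algebraD[OF L]])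
  also have "\<dots> = (\<integral>\<^sup>+\<omega>. \<integral>\<^sup>+y. f (Z \<omega>, y) \<partial>K \<omega> \<partial>M)"
    unfolding L_def
    by (intro nn_integral_cong nn_integral_distr pairZ) (simp_all add: f measurable_cong_sets[OF sets_distr refl])
  finally show ?thesis .
qed

text \<open>The integrand varies with \<open>x\<close> as well as the measure. Pushing
  \<open>L x\<close> forward along \<open>Pair x\<close> moves all dependence on \<open>x\<close>
  into the measure, and a fixed function integrates measurably against a measurable family.\<close>

lemma borel_measurable_integral_kernel:
  fixes f :: "'a \<times> 'b \<Rightarrow> real"
  assumes f[measurable]: "f \<in> borel_measurable (M \<Otimes>\<^sub>M N)"
    and L: "L \<in> M \<rightarrow>\<^sub>M prob_algebra N"
  shows "(\<lambda>x. \<integral>y. f (x, y) \<partial>L x) \<in> borel_measurable M"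
proof -
  have "(\<lambda>x. \<integral>p. f p \<partial>distr (L x) (M \<Otimes>\<^sub>M N) (Pair x)) \<in> borel_measurable M"
    by (rule measurable_compose[OF measurable_distr2[OF _ measurable_prob_algebraD[OF L]]
          integral_measurable_subprob_algebra[OF f]]) simp
  also have "?this \<longleftrightarrow> ?thesis"
  proof (rule measurable_cong, rule integral_distr)
    fix x assume x: "x \<in> space M"
    then have "sets (L x) = sets N"
      using measurable_space[OF L] by (simp add: space_prob_algebra)
    then show "Pair x \<in> L x \<rightarrow>\<^sub>M M \<Otimes>\<^sub>M N"
      using x by (simp cong: measurable_cong_sets)
  qed (rule f)
  finally show ?thesis .
qed

text \<open>Adding the bound \<open>c\<close> makes the integrand nonnegative, so the nonnegative
  version applies to \<open>f p + c\<close>. All measures involved have mass one, hence the shift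
  contributes exactly \<open>c\<close> on both sides and cancels.\<close>

lemma (in prob_space) integral_cond_kernel:
  fixes Y :: "'a \<Rightarrow> real" and K :: "'a \<Rightarrow> real measure" and f :: "_ \<Rightarrow> real"
  assumes sub: "subalgebra M F"
    and Z: "Z \<in> F \<rightarrow>\<^sub>M N"
    and Y[measurable]: "Y \<in> borel_measurable M"
    and K[measurable]: "K \<in> M \<rightarrow>\<^sub>M prob_algebra borel"
    and cond: "\<And>B. B \<in> sets borel \<Longrightarrow>
      AE \<omega> in M. real_cond_exp M F (\<lambda>\<omega>. indicator B (Y \<omega>)) \<omega> = measure (K \<omega>) B"
    and f[measurable]: "f \<in> borel_measurable (N \<Otimes>\<^sub>M borel)"
    and bdd: "\<And>p. \<bar>f p\<bar> \<le> c"
  shows "(\<lambda>\<omega>. \<integral>y. f (Z \<omega>, y) \<partial>K \<omega>) \<in> borel_measurable M"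
    and "(\<integral>\<omega>. f (Z \<omega>, Y \<omega>) \<partial>M) = (\<integral>\<omega>. \<integral>y. f (Z \<omega>, y) \<partial>K \<omega> \<partial>M)"
proof -
  have Z_M[measurable]: "Z \<in> M \<rightarrow>\<^sub>M N" by (rule measurable_from_subalg[OF sub Z])
  have setsK: "sets (K \<omega>) = sets borel" and probK: "prob_space (K \<omega>)" if "\<omega> \<in> space M" for \<omega>
    using measurable_space[OF K that] by (auto simp: space_prob_algebra)
  show meas[measurable]: "(\<lambda>\<omega>. \<integral>y. f (Z \<omega>, y) \<partial>K \<omega>) \<in> borel_measurable M"
    using borel_measurable_integral_kernel[OF _ K, of "\<lambda>p. f (Z (fst p), snd p)"] by simp
  have fK: "(\<lambda>y. f (Z \<omega>, y)) \<in> borel_measurable (K \<omega>)" if "\<omega> \<in> space M" for \<omega>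
    using measurable_compose[OF measurable_Pair1'[OF measurable_space[OF Z_M that]] f]
      measurable_cong_sets[OF setsK[OF that] refl] by blast
  have iK: "integrable (K \<omega>) (\<lambda>y. f (Z \<omega>, y))" if "\<omega> \<in> space M" for \<omega>
  proof -
    interpret K: prob_space "K \<omega>" by (rule probK[OF that])
    show ?thesis by (rule K.integrable_const_bound[where B=c]) (auto simp: bdd fK[OF that])
  qed
  have bK: "\<bar>\<integral>y. f (Z \<omega>, y) \<partial>K \<omega>\<bar> \<le> c" if "\<omega> \<in> space M" for \<omega>
  proof -
    interpret K: prob_space "K \<omega>" by (rule probK[OF that])
    have "\<bar>\<integral>y. f (Z \<omega>, y) \<partial>K \<omega>\<bar> \<le> (\<integral>y. \<bar>f (Z \<omega>, y)\<bar> \<partial>K \<omega>)" by (rule integral_abs_bound)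
    also have "\<dots> \<le> (\<integral>y. c \<partial>K \<omega>)"
      by (intro integral_mono bdd integrable_abs iK that) simp
    finally show ?thesis by (simp add: K.prob_space)
  qed
  have i1: "integrable M (\<lambda>\<omega>. f (Z \<omega>, Y \<omega>))"
    by (rule integrable_const_bound[where B=c]) (auto simp: bdd)
  have i2: "integrable M (\<lambda>\<omega>. \<integral>y. f (Z \<omega>, y) \<partial>K \<omega>)"
    by (rule integrable_const_bound[where B=c]) (auto simp: bK)
  have pos: "0 \<le> f p + c" for p using bdd[of p] by linarith
  have posK: "0 \<le> (\<integral>y. f (Z \<omega>, y) \<partial>K \<omega>) + c" if "\<omega> \<in> space M" for \<omega>
    using bK[OF that] by linarith
  have "ennreal ((\<integral>\<omega>. f (Z \<omega>, Y \<omega>) \<partial>M) + c) = ennreal (\<integral>\<omega>. f (Z \<omega>, Y \<omega>) + c \<partial>M)"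
    using i1 by (simp add: prob_space)
  also have "\<dots> = (\<integral>\<^sup>+\<omega>. ennreal (f (Z \<omega>, Y \<omega>) + c) \<partial>M)"
    using i1 by (intro nn_integral_eq_integral[symmetric]) (auto simp: pos)
  also have "\<dots> = (\<integral>\<^sup>+\<omega>. \<integral>\<^sup>+y. ennreal (f (Z \<omega>, y) + c) \<partial>K \<omega> \<partial>M)"
    by (rule nn_integral_cond_kernel[OF sub Z Y K cond, where f="\<lambda>p. ennreal (f p + c)"]) auto
  also have "\<dots> = (\<integral>\<^sup>+\<omega>. ennreal ((\<integral>y. f (Z \<omega>, y) \<partial>K \<omega>) + c) \<partial>M)"
  proof (rule nn_integral_cong)
    fix \<omega> assume \<omega>: "\<omega> \<in> space M"
    interpret K: prob_space "K \<omega>" by (rule probK[OF \<omega>])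
    show "(\<integral>\<^sup>+y. ennreal (f (Z \<omega>, y) + c) \<partial>K \<omega>) = ennreal ((\<integral>y. f (Z \<omega>, y) \<partial>K \<omega>) + c)"
      using iK[OF \<omega>] by (subst nn_integral_eq_integral) (auto simp: pos K.prob_space)
  qed
  also have "\<dots> = ennreal (\<integral>\<omega>. (\<integral>y. f (Z \<omega>, y) \<partial>K \<omega>) + c \<partial>M)"
    using i2 posK by (intro nn_integral_eq_integral) auto
  also have "\<dots> = ennreal ((\<integral>\<omega>. \<integral>y. f (Z \<omega>, y) \<partial>K \<omega> \<partial>M) + c)"
    using i2 by (simp add: prob_space)
  finally have eq: "ennreal ((\<integral>\<omega>. f (Z \<omega>, Y \<omega>) \<partial>M) + c) = ennreal ((\<integral>\<omega>. \<integral>y. f (Z \<omega>, y) \<partial>K \<omega> \<partial>M) + c)" .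
  \<comment> \<open>\<open>ennreal\<close> sends all negative reals to zero; both sides must be
    known to be nonnegative before it can be stripped from \<open>eq\<close>.\<close>
  have "0 \<le> (\<integral>\<omega>. f (Z \<omega>, Y \<omega>) + c \<partial>M)" by (intro integral_nonneg_AE AE_I2 pos)
  moreover have "0 \<le> (\<integral>\<omega>. (\<integral>y. f (Z \<omega>, y) \<partial>K \<omega>) + c \<partial>M)" by (intro integral_nonneg_AE AE_I2 posK)
  ultimately show "(\<integral>\<omega>. f (Z \<omega>, Y \<omega>) \<partial>M) = (\<integral>\<omega>. \<integral>y. f (Z \<omega>, y) \<partial>K \<omega> \<partial>M)"
    using eq i1 i2 by (simp add: prob_space)
qed

section \<open>Co-monotony at finitely many times\<close>

lemma measurable_fun_upd_borel:
  fixes k :: nat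
  shows "(\<lambda>(z, y). z(k := y)) \<in> borel \<Otimes>\<^sub>M borel \<rightarrow>\<^sub>M (borel :: (nat \<Rightarrow> real) measure)"
proof (rule measurable_coordinatewise_then_product)
  fix i
  have [measurable]: "(\<lambda>z::nat \<Rightarrow> real. z i) \<in> borel_measurable borel"
    by (rule measurable_product_coordinates)
  show "(\<lambda>x. (case x of (z, y) \<Rightarrow> z(k := y)) i) \<in> borel_measurable (borel \<Otimes>\<^sub>M borel)"
  proof (cases "i = k")
    case False
    have "(\<lambda>x. fst x i) \<in> borel \<Otimes>\<^sub>M borel \<rightarrow>\<^sub>M borel"
      by (rule measurable_compose[OF measurable_fst measurable_product_coordinates])
    with False show ?thesis by (simp add: case_prod_beta')
  qed (simp add: case_prod_beta')
qed

lemma measurable_natural_filtration: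
  assumes "u \<in> {0..s}"
  shows "X u \<in> borel_measurable (natural_filtration M X s)"
proof (rule measurableI)
  fix B :: "real set" assume "B \<in> sets borel"
  then show "X u -` B \<inter> space (natural_filtration M X s) \<in> sets (natural_filtration M X s)"
    using assms unfolding natural_filtration_def
    by (subst space_measure_of, blast, subst sets_measure_of, blast) (blast intro: sigma_sets.Basic)
qed simp

lemma subalgebra_natural_filtration:
  assumes "\<And>u. u \<in> {0..s} \<Longrightarrow> X u \<in> borel_measurable M"
  shows "subalgebra M (natural_filtration M X s)"
proof -
  let ?G = "{X u -` B \<inter> space M |u B. u \<in> {0..s} \<and> B \<in> sets borel}"
  have "?G \<subseteq> Pow (space M)" by blast
  moreover have "?G \<subseteq> sets M" using measurable_sets[OF assms] by blast
  ultimately show ?thesis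
    unfolding subalgebra_def natural_filtration_def
    by (simp add: space_measure_of sets_measure_of sets.sigma_sets_subset)
qed

text \<open>Vectors are sequences set to zero from index \<open>k\<close> on, so \<open>f\<close>
  and \<open>g\<close> keep their type throughout the induction on \<open>k\<close>. They are
  generalised because the induction hypothesis is applied to their one-step conditional averages.
  The times need only be nondecreasing, so repetitions are allowed.\<close>

lemma finite_dimensional_comonotony:
  fixes M :: "'a measure" and X :: "real \<Rightarrow> 'a \<Rightarrow> real" and f g :: "(nat \<Rightarrow> real) \<Rightarrow> real"
  assumes "prob_space M"
    and markov: "markov_process M T X P"
    and monotony: "\<And>s t. 0 \<le> s \<Longrightarrow> s \<le> t \<Longrightarrow> t \<le> T \<Longrightarrow> monotony_preserving (P s t)"
    and \<tau>: "mono \<tau>" "\<And>i. \<tau> i \<in> {0..T}"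
    and "f \<in> borel_measurable borel" "g \<in> borel_measurable borel"
    and "mono f" "mono g" "\<And>z. \<bar>f z\<bar> \<le> c" "\<And>z. \<bar>g z\<bar> \<le> c"
  defines "Z \<equiv> \<lambda>k \<omega> i. if i < k then X (\<tau> i) \<omega> else 0"
  shows "(\<integral>\<omega>. f (Z k \<omega>) \<partial>M) * (\<integral>\<omega>. g (Z k \<omega>) \<partial>M) \<le> (\<integral>\<omega>. f (Z k \<omega>) * g (Z k \<omega>) \<partial>M)"
  using assms(6-11)
proof (induction k arbitrary: f g c)
  case 0
  interpret prob_space M by fact
  show ?case by (simp add: Z_def prob_space)
next
  case (Suc k)
  interpret prob_space M by fact
  note [measurable] = Suc.prems(1,2)
  note mono_fg = Suc.prems(3,4) and bdd = Suc.prems(5,6)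
  have X[measurable]: "X t \<in> borel_measurable M" if "t \<in> {0..T}" for t
    using markov that by (auto simp: markov_process_def)
  have Z_Suc: "Z (Suc k) \<omega> = (Z k \<omega>)(k := X (\<tau> k) \<omega>)" for \<omega>
    by (auto simp: Z_def fun_eq_iff)
  have mono_upd: "mono (\<lambda>y. h (z(k := y)))" if "mono h" for h :: "(nat \<Rightarrow> real) \<Rightarrow> real" and z
    using that by (auto simp: mono_def le_fun_def)
  note meas_upd = measurable_fun_upd_borel[of k]
  have meas_sec: "(\<lambda>y. h (z(k := y))) \<in> borel_measurable borel"
    if "h \<in> borel_measurable borel" for h :: "(nat \<Rightarrow> real) \<Rightarrow> real" and z
    using measurable_compose[OF measurable_compose[OF measurable_Pair1' meas_upd] that, of z] by simp
  \<comment> \<open>Sections in coordinate \<open>k\<close> are both nondecreasing on a linear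
    order, so their increments have the same sign.\<close>
  have co: "0 \<le> (f (z(k := x)) - f (z(k := y))) * (g (z(k := x)) - g (z(k := y)))" for z x y
    using monoD[OF mono_upd[OF mono_fg(1)], of x y z] monoD[OF mono_upd[OF mono_fg(2)], of x y z]
      monoD[OF mono_upd[OF mono_fg(1)], of y x z] monoD[OF mono_upd[OF mono_fg(2)], of y x z]
    by (cases x y rule: linorder_le_cases) (simp_all del: fun_upd_apply add: zero_le_mult_iff)
  have X\<tau>[measurable]: "X (\<tau> i) \<in> borel_measurable M" for i
    by (rule X[OF \<tau>(2)])
  show ?case
  proof (cases k)
    case 0
    \<comment> \<open>With a single coordinate there is no past to condition on, and the
      one-variable inequality applies under \<open>M\<close> itself.\<close>
    have Z1: "Z (Suc k) \<omega> = (\<lambda>_. 0)(k := X (\<tau> k) \<omega>)" for \<omega>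
      unfolding Z_Suc using 0 by (simp add: Z_def)
    note meas = measurable_compose[OF X\<tau> meas_sec]
    show ?thesis unfolding Z1
      by (rule integral_mult_ge_of_comonotone[where c=c])
         (rule meas Suc.prems(1,2) bdd co)+
  next
    case (Suc j)
    \<comment> \<open>\<open>s\<close> is the last observation time before \<open>\<tau> k\<close>.
      Conditioning on the past up to \<open>s\<close> turns the law of \<open>X (\<tau> k)\<close>
      into the transition from \<open>X s\<close>.\<close>
    define s where "s = \<tau> j"
    define F where "F = natural_filtration M X s"
    define K where "K = P s (\<tau> k)"
    have st: "0 \<le> s" "s \<le> \<tau> k" "\<tau> k \<le> T"
      using \<tau>(2)[of j] \<tau>(2)[of k] monoD[OF \<tau>(1), of j k] by (auto simp: s_def Suc)
    have K[measurable]: "K \<in> borel \<rightarrow>\<^sub>M prob_algebra borel"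
      and cond: "\<And>B. B \<in> sets borel \<Longrightarrow>
        AE \<omega> in M. real_cond_exp M F (\<lambda>\<omega>. indicator B (X (\<tau> k) \<omega>)) \<omega> = measure (K (X s \<omega>)) B"
      using markov st by (auto simp: markov_process_def K_def F_def)
    have probK: "prob_space (K x)" and setsK: "sets (K x) = sets borel" for x
      using measurable_space[OF K, of x] by (auto simp: space_prob_algebra)
    have mpK: "monotony_preserving (K)" unfolding K_def by (rule monotony[OF st])
    have sub: "subalgebra M F"
      unfolding F_def using st by (intro subalgebra_natural_filtration X) auto
    \<comment> \<open>All earlier times lie in \<open>{0..s}\<close> because \<open>\<tau>\<close>
      is nondecreasing, so the first \<open>k\<close> coordinates belong to the past.\<close>
    have Z_F: "Z k \<in> borel_measurable F"
    proof (rule measurable_coordinatewise_then_product)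
      fix i
      show "(\<lambda>\<omega>. Z k \<omega> i) \<in> borel_measurable F"
      proof (cases "i < k")
        case True
        then have "\<tau> i \<in> {0..s}"
          using \<tau>(2)[of i] monoD[OF \<tau>(1), of i j] by (auto simp: s_def Suc)
        then show ?thesis using True measurable_natural_filtration[of "\<tau> i" s X M] by (simp add: Z_def F_def)
      qed (simp add: Z_def)
    qed
    have KX: "(\<lambda>\<omega>. K (X s \<omega>)) \<in> M \<rightarrow>\<^sub>M prob_algebra borel"
      unfolding s_def by measurable
    \<comment> \<open>\<open>Q h\<close> integrates out coordinate \<open>k\<close> under the
      transition started at coordinate \<open>j\<close>; \<open>Q h (Z k \<omega>)\<close> takes the
      place of the conditional expectation of \<open>h (Z (Suc k) \<omega>)\<close> given
      \<open>F\<close>.\<close>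
    define Q where "Q h z = (\<integral>y. h (z(k := y)) \<partial>K (z j))" for h :: "(nat \<Rightarrow> real) \<Rightarrow> real" and z
    have Z_j: "Z k \<omega> j = X s \<omega>" for \<omega> by (simp add: Z_def s_def Suc)
    have E: "(\<integral>\<omega>. h (Z (Suc k) \<omega>) \<partial>M) = (\<integral>\<omega>. Q h (Z k \<omega>) \<partial>M)"
      if h[measurable]: "h \<in> borel_measurable borel" and b: "\<And>z. \<bar>h z\<bar> \<le> d" for h d
      unfolding Q_def Z_j Z_Suc
      using integral_cond_kernel(2)[OF sub Z_F X\<tau> KX cond measurable_compose[OF meas_upd h], of d] b
      by (simp add: case_prod_beta')
    have Q_meas: "Q h \<in> borel_measurable borel" if h[measurable]: "h \<in> borel_measurable borel" for h
    proof -
      have [measurable]: "(\<lambda>z::nat \<Rightarrow> real. z j) \<in> borel_measurable borel"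
        by (rule measurable_product_coordinates)
      have "(\<lambda>z. K (z j)) \<in> borel \<rightarrow>\<^sub>M prob_algebra borel" by measurable
      from borel_measurable_integral_kernel[OF measurable_compose[OF meas_upd h] this]
      show ?thesis by (simp add: Q_def[abs_def])
    qed
    have int: "integrable (K x) (\<lambda>y. h (z(k := y)))"
      if "h \<in> borel_measurable borel" "\<And>z. \<bar>h z\<bar> \<le> d" for h z x and d :: real
    proof -
      interpret K: prob_space "K x" by (rule probK)
      show ?thesis
        using meas_sec[OF that(1), of z] measurable_cong_sets[OF setsK refl, of x]
        by (intro K.integrable_const_bound[where B=d]) (auto simp: that)
    qed
    have Q_bdd: "\<bar>Q h z\<bar> \<le> d" if h: "h \<in> borel_measurable borel" "\<And>z. \<bar>h z\<bar> \<le> d" for h z d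
    proof -
      interpret K: prob_space "K (z j)" by (rule probK)
      have "\<bar>Q h z\<bar> \<le> (\<integral>y. \<bar>h (z(k := y))\<bar> \<partial>K (z j))" unfolding Q_def by (rule integral_abs_bound)
      also have "\<dots> \<le> (\<integral>y. d \<partial>K (z j))"
        by (intro integral_mono integrable_abs int[OF h] h) simp
      finally show ?thesis by (simp add: K.prob_space)
    qed
    have Q_mono: "mono (Q h)" if h: "h \<in> borel_measurable borel" "\<And>z. \<bar>h z\<bar> \<le> d" "mono h" for h d
    proof (rule monoI)
      fix z w :: "nat \<Rightarrow> real" assume zw: "z \<le> w"
      have "Q h z \<le> (\<integral>y. h (w(k := y)) \<partial>K (z j))"
        unfolding Q_def using zw
        by (intro integral_mono int[OF h(1,2)] monoD[OF h(3)]) (auto simp: le_fun_def)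
      \<comment> \<open>The starting point then moves from \<open>z j\<close> to \<open>w j\<close>;
        this is where monotony preservation enters, for the bounded monotone section of
        \<open>h\<close> at \<open>w\<close>.\<close>
      also have "mono (\<lambda>x. \<integral>y. h (w(k := y)) \<partial>K x)"
      proof -
        have "bounded (range (\<lambda>y. h (w(k := y))))"
          by (rule boundedI[where B=d]) (auto simp del: fun_upd_apply simp: h(2))
        with mpK mono_upd[OF h(3), of w] show ?thesis
          unfolding monotony_preserving_def by blast
      qed
      then have "(\<integral>y. h (w(k := y)) \<partial>K (z j)) \<le> Q h w"
        unfolding Q_def using zw by (auto simp: le_fun_def dest: monoD)
      finally show "Q h z \<le> Q h w" .
    qed
    have fg_bdd: "\<bar>f z * g z\<bar> \<le> c * c" for z
      using bdd by (auto simp: abs_mult intro!: mult_mono order_trans[OF abs_ge_zero bdd(1)])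
    have Z_M[measurable]: "Z k \<in> borel_measurable M" by (rule measurable_from_subalg[OF sub Z_F])
    note Q_meas[measurable]
    \<comment> \<open>This is the conditional Chebyshev inequality, under the probability
      \<open>K (z j)\<close>.\<close>
    have Q_le: "Q f z * Q g z \<le> Q (\<lambda>z. f z * g z) z" for z
      unfolding Q_def
      by (rule prob_space.integral_mult_ge_of_comonotone[OF probK, where c=c])
         (subst measurable_cong_sets[OF setsK refl] | rule meas_sec Suc.prems(1,2) bdd co)+
    have Q_prod: "\<bar>Q f z * Q g z\<bar> \<le> c * c" for z
      using Q_bdd[of f c z] Q_bdd[of g c z] bdd
      by (auto simp: abs_mult intro!: mult_mono order_trans[OF abs_ge_zero bdd(1)])
    \<comment> \<open>The last coordinate is integrated out of each factor, the induction hypothesis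
      is applied to \<open>Q f\<close> and \<open>Q g\<close>, and the conditional inequality
      restores the product before the coordinate is put back.\<close>
    have "(\<integral>\<omega>. f (Z (Suc k) \<omega>) \<partial>M) * (\<integral>\<omega>. g (Z (Suc k) \<omega>) \<partial>M)
        = (\<integral>\<omega>. Q f (Z k \<omega>) \<partial>M) * (\<integral>\<omega>. Q g (Z k \<omega>) \<partial>M)"
      using bdd by (simp add: E[of _ c])
    also have "\<dots> \<le> (\<integral>\<omega>. Q f (Z k \<omega>) * Q g (Z k \<omega>) \<partial>M)"
      by (rule Suc.IH[where c=c]) (auto intro!: Q_mono[of _ c] Q_bdd bdd mono_fg)
    also have "\<dots> \<le> (\<integral>\<omega>. Q (\<lambda>z. f z * g z) (Z k \<omega>) \<partial>M)"
      by (intro integral_mono Q_le integrable_const_bound[where B="c * c"])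
         (auto simp: Q_prod intro!: Q_bdd fg_bdd)
    also have "\<dots> = (\<integral>\<omega>. f (Z (Suc k) \<omega>) * g (Z (Suc k) \<omega>) \<partial>M)"
      by (rule E[symmetric, of _ "c * c"]) (auto intro!: fg_bdd)
    finally show ?thesis .
  qed
qed

section \<open>Path space as an image of bounded continuous functions\<close>

text \<open>On a compact interval, continuity already supplies the boundedness that
  \<open>cfunspace\<close> demands.\<close>

lemma mem_path_space_iff:
  "\<alpha> \<in> path_space T \<longleftrightarrow> \<alpha> \<in> extensional {0..T} \<and> continuous_on {0..T} \<alpha>"
  by (subst compactin_mspace_cfunspace) (auto simp: compactin_subtopology)

lemma restrict_bcontfun_in_path_space:
  "restrict (apply_bcontfun b) {0..T} \<in> path_space T"
  unfolding mem_path_space_iff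
  using continuous_on_cong[of "{0..T}" "{0..T}" "restrict (apply_bcontfun b) {0..T}" "apply_bcontfun b"]
  by (simp del: restrict_apply) simp

text \<open>Restriction does not increase sup-distances, so the preimage of a ball contains the ball
  of the same radius. Continuity is phrased through preimages because the path topology is a value,
  not a type-class instance.\<close>

lemma open_restrict_bcontfun:
  assumes U: "openin (path_topology T) U"
  shows "open {b. restrict (apply_bcontfun b) {0..T} \<in> U}"
  unfolding open_dist
proof
  fix b :: "real \<Rightarrow>\<^sub>C real"
  assume "b \<in> {b. restrict (apply_bcontfun b) {0..T} \<in> U}"
  then have b: "restrict (apply_bcontfun b) {0..T} \<in> U" by simp
  interpret Metric_space "path_space T" "mdist (path_metric T)"
    by (rule Metric_space_mspace_mdist)
  obtain r where r: "r > 0" "mball (restrict (apply_bcontfun b) {0..T}) r \<subseteq> U"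
    using U b unfolding mtopology_of_def openin_mtopology by blast
  have "restrict (apply_bcontfun a) {0..T} \<in> U" if "dist a b < r" for a
  proof -
    have "mdist (path_metric T) (restrict (apply_bcontfun b) {0..T}) (restrict (apply_bcontfun a) {0..T}) \<le> dist b a"
      by (rule mdist_cfunspace_le) (auto simp: dist_bounded)
    also have "\<dots> < r" using that by (simp add: dist_commute)
    finally have "restrict (apply_bcontfun a) {0..T} \<in> mball (restrict (apply_bcontfun b) {0..T}) r"
      unfolding in_mball by (intro conjI restrict_bcontfun_in_path_space)
    with r(2) show ?thesis by (rule subsetD)
  qed
  with r(1) show "\<exists>e>0. \<forall>a. dist a b < e \<longrightarrow> a \<in> {b. restrict (apply_bcontfun b) {0..T} \<in> U}"
    by blast
qed

lemma measurable_restrict_bcontfun: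
  "(\<lambda>b. restrict (apply_bcontfun b) {0..T}) \<in> borel \<rightarrow>\<^sub>M path_borel T"
  unfolding path_borel_def
proof (rule measurable_measure_of)
  show "{U. openin (path_topology T) U} \<subseteq> Pow (path_space T)"
    using openin_subset by fastforce
  show "(\<lambda>b. restrict (apply_bcontfun b) {0..T}) \<in> space borel \<rightarrow> path_space T"
    using restrict_bcontfun_in_path_space by blast
  fix U assume "U \<in> {U. openin (path_topology T) U}"
  then have "{b. restrict (apply_bcontfun b) {0..T} \<in> U} \<in> sets borel"
    by (intro borel_open open_restrict_bcontfun) simp
  then show "(\<lambda>b. restrict (apply_bcontfun b) {0..T}) -` U \<inter> space borel \<in> sets borel"
    by (simp add: vimage_def)
qed

section \<open>Bernstein approximation of paths\<close>

text \<open>Rescaling time and clamping it to the unit interval extends a continuous function on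
  \<open>{0..1}\<close> to a bounded continuous function on the line, with constant tails.\<close>

definition unit_clamp :: "real \<Rightarrow> real \<Rightarrow> real" where
  "unit_clamp T t = max 0 (min 1 (t / T))"

lemma unit_clamp_mem [simp]: "unit_clamp T t \<in> {0..1}"
  and unit_clamp_nonneg [simp]: "0 \<le> unit_clamp T t"
  and unit_clamp_le_1 [simp]: "unit_clamp T t \<le> 1"
  by (auto simp: unit_clamp_def)

lemma mult_unit_clamp: "0 < T \<Longrightarrow> t \<in> {0..T} \<Longrightarrow> T * unit_clamp T t = t"
  by (auto simp: unit_clamp_def max_def min_def field_simps)

lemma bcontfun_comp_unit_clamp:
  fixes h :: "real \<Rightarrow> real"
  assumes "continuous_on {0..1} h"
  shows "(\<lambda>t. h (unit_clamp T t)) \<in> bcontfun"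
proof -
  have "continuous_on UNIV (unit_clamp T)"
    unfolding unit_clamp_def divide_inverse by (intro continuous_intros)
  then have "continuous_on UNIV (\<lambda>t. h (unit_clamp T t))"
    by (rule continuous_on_compose2[OF assms]) auto
  moreover have "bounded (h ` {0..1})"
    by (intro compact_imp_bounded compact_continuous_image assms) simp
  then have "bounded (range (\<lambda>t. h (unit_clamp T t)))"
    by (rule bounded_subset) (auto intro!: imageI)
  ultimately show ?thesis by (simp add: bcontfun_def)
qed

text \<open>This is the Bernstein polynomial with node values \<open>z 0, ..., z n\<close>, rescaled
  to \<open>{0..T}\<close>. Written as a combination of fixed vectors in a normed space, it is
  visibly continuous in \<open>z\<close>.\<close>

definition bernstein_path :: "real \<Rightarrow> nat \<Rightarrow> (nat \<Rightarrow> real) \<Rightarrow> real \<Rightarrow>\<^sub>C real" where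
  "bernstein_path T n z = (\<Sum>i\<le>n. z i *\<^sub>R Bcontfun (\<lambda>t. Bernstein n i (unit_clamp T t)))"

lemma apply_bcontfun_sum:
  "apply_bcontfun (\<Sum>i\<in>A. f i) t = (\<Sum>i\<in>A. apply_bcontfun (f i) t)"
  by (induction A rule: infinite_finite_induct) simp_all

lemma apply_bernstein_path:
  "apply_bcontfun (bernstein_path T n z) t = (\<Sum>i\<le>n. z i * Bernstein n i (unit_clamp T t))"
proof -
  have "continuous_on {0..1} (Bernstein n i)" for i
    unfolding Bernstein_def[abs_def] by (intro continuous_intros)
  from Bcontfun_inverse[OF bcontfun_comp_unit_clamp[OF this]] show ?thesis
    by (simp add: bernstein_path_def apply_bcontfun_sum)
qed

text \<open>Bernstein basis polynomials are nonnegative on the unit interval, where clamping keeps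
  their argument.\<close>

lemma bernstein_path_mono:
  "z \<le> w \<Longrightarrow> apply_bcontfun (bernstein_path T n z) t \<le> apply_bcontfun (bernstein_path T n w) t"
  unfolding apply_bernstein_path
  by (intro sum_mono mult_right_mono Bernstein_nonneg) (auto simp: le_fun_def)

lemma borel_measurable_bernstein_path [measurable]: "bernstein_path T n \<in> borel_measurable borel"
  unfolding bernstein_path_def[abs_def]
  by (intro borel_measurable_continuous_onI continuous_on_sum continuous_on_scaleR
      continuous_on_product_coordinates continuous_on_const)

lemma bernstein_path_tendsto:
  fixes \<alpha> :: "real \<Rightarrow> real"
  assumes T: "0 < T" and \<alpha>: "continuous_on {0..T} \<alpha>"
    and z: "\<And>n i. i \<le> n \<Longrightarrow> z n i = \<alpha> (T * (real i / real n))"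
  shows "(\<lambda>n. bernstein_path T n (z n)) \<longlonglongrightarrow> Bcontfun (\<lambda>t. \<alpha> (T * unit_clamp T t))"
proof (rule metric_LIMSEQ_I)
  have cont: "continuous_on {0..1} (\<lambda>x. \<alpha> (T * x))"
    using T by (intro continuous_on_compose2[OF \<alpha>] continuous_intros) (auto simp: mult_le_cancel_left1)
  have Y: "apply_bcontfun (Bcontfun (\<lambda>t. \<alpha> (T * unit_clamp T t))) t = \<alpha> (T * unit_clamp T t)" for t
    using Bcontfun_inverse[OF bcontfun_comp_unit_clamp[OF cont]] by simp
  fix e :: real assume "0 < e"
  \<comment> \<open>A strict pointwise bound passes to the supremum only as a weak one, hence
    \<open>e / 2\<close>.\<close>
  then obtain N where N: "\<And>n x. N \<le> n \<Longrightarrow> x \<in> {0..1} \<Longrightarrow>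
      \<bar>\<alpha> (T * x) - (\<Sum>k\<le>n. \<alpha> (T * (real k / real n)) * Bernstein n k x)\<bar> < e / 2"
    using Bernstein_Weierstrass[OF cont, of "e / 2"] by auto
  have "dist (bernstein_path T n (z n)) (Bcontfun (\<lambda>t. \<alpha> (T * unit_clamp T t))) < e" if "N \<le> n" for n
  proof -
    have "dist (bernstein_path T n (z n)) (Bcontfun (\<lambda>t. \<alpha> (T * unit_clamp T t))) \<le> e / 2"
    proof (rule dist_bound)
      fix t
      show "dist (apply_bcontfun (bernstein_path T n (z n)) t)
          (apply_bcontfun (Bcontfun (\<lambda>t. \<alpha> (T * unit_clamp T t))) t) \<le> e / 2"
        using N[OF that unit_clamp_mem[of T t]]
        by (simp add: Y apply_bernstein_path z dist_real_def abs_minus_commute)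
    qed
    with \<open>0 < e\<close> show ?thesis by simp
  qed
  then show "\<exists>N. \<forall>n\<ge>N. dist (bernstein_path T n (z n)) (Bcontfun (\<lambda>t. \<alpha> (T * unit_clamp T t))) < e"
    by blast
qed

text \<open>For \<open>0 < T\<close> and a continuous path this is the sample path extended by its
  end values to the whole line.\<close>

definition bcontfun_path :: "real \<Rightarrow> (real \<Rightarrow> 'a \<Rightarrow> real) \<Rightarrow> 'a \<Rightarrow> real \<Rightarrow>\<^sub>C real" where
  "bcontfun_path T X \<omega> = Bcontfun (\<lambda>t. X (T * unit_clamp T t) \<omega>)"

lemma restrict_bcontfun_path:
  assumes T: "0 < T" and cont: "continuous_on {0..T} (\<lambda>t. X t \<omega>)"
  shows "restrict (apply_bcontfun (bcontfun_path T X \<omega>)) {0..T} = sample_path T X \<omega>"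
proof -
  have "continuous_on {0..1} (\<lambda>x. X (T * x) \<omega>)"
    using T by (intro continuous_on_compose2[OF cont] continuous_intros) (auto simp: mult_le_cancel_left1)
  from Bcontfun_inverse[OF bcontfun_comp_unit_clamp[OF this]] show ?thesis
    using T by (auto simp: bcontfun_path_def sample_path_def restrict_def fun_eq_iff mult_unit_clamp)
qed

text \<open>The cap \<open>min 1\<close> keeps the sampling times in \<open>{0..T}\<close> for every
  index, as the finite-dimensional inequality requires. Up to index \<open>n\<close> it changes
  nothing, also for \<open>n = 0\<close>, where the quotient is 0.\<close>

lemma bernstein_path_tendsto_bcontfun_path:
  assumes T: "0 < T" and cont: "continuous_on {0..T} (\<lambda>t. X t \<omega>)"
  shows "(\<lambda>n. bernstein_path T n (\<lambda>i. if i < Suc n then X (T * min 1 (real i / real n)) \<omega> else 0))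
    \<longlonglongrightarrow> bcontfun_path T X \<omega>"
  unfolding bcontfun_path_def
proof (rule bernstein_path_tendsto[OF T cont])
  fix n i :: nat assume "i \<le> n"
  then have "real i / real n \<le> 1" by (cases "n = 0") auto
  then show "(if i < Suc n then X (T * min 1 (real i / real n)) \<omega> else 0) = X (T * (real i / real n)) \<omega>"
    using \<open>i \<le> n\<close> by simp
qed

section \<open>Passage to the limit\<close>

lemma comonotony_bcontfun_path:
  fixes M :: "'a measure" and X :: "real \<Rightarrow> 'a \<Rightarrow> real" and F G :: "(real \<Rightarrow>\<^sub>C real) \<Rightarrow> real"
  assumes "prob_space M" and T: "0 < T"
    and cont: "\<And>\<omega>. \<omega> \<in> space M \<Longrightarrow> continuous_on {0..T} (\<lambda>t. X t \<omega>)"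
    and markov: "markov_process M T X P"
    and monotony: "\<And>s t. 0 \<le> s \<Longrightarrow> s \<le> t \<Longrightarrow> t \<le> T \<Longrightarrow> monotony_preserving (P s t)"
    and FG[measurable]: "F \<in> borel_measurable borel" "G \<in> borel_measurable borel"
    and mono: "\<And>a b. (\<And>t. apply_bcontfun a t \<le> apply_bcontfun b t) \<Longrightarrow> F a \<le> F b"
      "\<And>a b. (\<And>t. apply_bcontfun a t \<le> apply_bcontfun b t) \<Longrightarrow> G a \<le> G b"
    and bdd: "\<And>b. \<bar>F b\<bar> \<le> c" "\<And>b. \<bar>G b\<bar> \<le> c"
    and AE_cont: "AE \<omega> in M. isCont F (bcontfun_path T X \<omega>)" "AE \<omega> in M. isCont G (bcontfun_path T X \<omega>)"
    and meas[measurable]: "bcontfun_path T X \<in> borel_measurable M"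
  shows "(\<integral>\<omega>. F (bcontfun_path T X \<omega>) \<partial>M) * (\<integral>\<omega>. G (bcontfun_path T X \<omega>) \<partial>M)
    \<le> (\<integral>\<omega>. F (bcontfun_path T X \<omega>) * G (bcontfun_path T X \<omega>) \<partial>M)"
proof -
  interpret prob_space M by fact
  define \<tau> where "\<tau> n i = T * min 1 (real i / real n)" for n i :: nat
  define Z where "Z n \<omega> i = (if i < Suc n then X (\<tau> n i) \<omega> else 0)" for n i \<omega>
  define B where "B n \<omega> = bernstein_path T n (Z n \<omega>)" for n \<omega>
  have \<tau>_mono: "mono (\<tau> n)" for n
    unfolding \<tau>_def using T by (intro monoI mult_left_mono min.mono divide_right_mono) auto
  have \<tau>_mem: "\<tau> n i \<in> {0..T}" for n i
    using T by (auto simp: \<tau>_def mult_le_cancel_left1)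
  have [measurable]: "X (\<tau> n i) \<in> borel_measurable M" for n i
    using markov \<tau>_mem by (auto simp: markov_process_def)
  have Z_meas[measurable]: "Z n \<in> borel_measurable M" for n
  proof (rule measurable_coordinatewise_then_product)
    show "(\<lambda>\<omega>. Z n \<omega> i) \<in> borel_measurable M" for i
      unfolding Z_def by (cases "i < Suc n") simp_all
  qed
  have B_meas[measurable]: "B n \<in> borel_measurable M" for n
    unfolding B_def[abs_def] by measurable
  have B_lim: "(\<lambda>n. B n \<omega>) \<longlonglongrightarrow> bcontfun_path T X \<omega>" if "\<omega> \<in> space M" for \<omega>
    unfolding B_def Z_def[abs_def] \<tau>_def by (rule bernstein_path_tendsto_bcontfun_path[where X=X, OF T cont[OF that]])
  \<comment> \<open>Continuity of \<open>H\<close> is required only at the limiting path, so almost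
    sure continuity gives almost sure convergence; the bound \<open>d\<close> dominates. The
    statement serves \<open>F\<close>, \<open>G\<close> and their product.\<close>
  have lim: "(\<lambda>n. \<integral>\<omega>. H (B n \<omega>) \<partial>M) \<longlonglongrightarrow> (\<integral>\<omega>. H (bcontfun_path T X \<omega>) \<partial>M)"
    if [measurable]: "H \<in> borel_measurable borel" and b: "\<And>b. \<bar>H b\<bar> \<le> d"
      and c: "AE \<omega> in M. isCont H (bcontfun_path T X \<omega>)" for H :: "_ \<Rightarrow> real" and d
  proof (rule integral_dominated_convergence[where w="\<lambda>_. d"])
    show "AE \<omega> in M. (\<lambda>n. H (B n \<omega>)) \<longlonglongrightarrow> H (bcontfun_path T X \<omega>)"
      using c AE_space
    proof eventually_elim
      case (elim \<omega>)
      show ?case by (rule isCont_tendsto_compose[OF elim(1) B_lim[OF elim(2)]])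
    qed
  qed (auto simp: b)
  have FG_bdd: "\<bar>F b * G b\<bar> \<le> c * c" for b
    using bdd by (auto simp: abs_mult intro!: mult_mono order_trans[OF abs_ge_zero bdd(1)])
  show ?thesis
  proof (rule LIMSEQ_le)
    show "(\<lambda>n. (\<integral>\<omega>. F (B n \<omega>) \<partial>M) * (\<integral>\<omega>. G (B n \<omega>) \<partial>M)) \<longlonglongrightarrow>
        (\<integral>\<omega>. F (bcontfun_path T X \<omega>) \<partial>M) * (\<integral>\<omega>. G (bcontfun_path T X \<omega>) \<partial>M)"
      by (rule tendsto_mult[OF lim[OF FG(1) bdd(1) AE_cont(1)] lim[OF FG(2) bdd(2) AE_cont(2)]])
    show "(\<lambda>n. \<integral>\<omega>. F (B n \<omega>) * G (B n \<omega>) \<partial>M) \<longlonglongrightarrow>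
        (\<integral>\<omega>. F (bcontfun_path T X \<omega>) * G (bcontfun_path T X \<omega>) \<partial>M)"
    proof (rule lim[OF _ FG_bdd])
      show "AE \<omega> in M. isCont (\<lambda>b. F b * G b) (bcontfun_path T X \<omega>)"
        using AE_cont by eventually_elim (rule isCont_mult)
    qed measurable
    \<comment> \<open>Degree \<open>n\<close> uses the \<open>n + 1\<close> nodes
      \<open>0, ..., n\<close>, so the finite-dimensional inequality is taken with
      \<open>Suc n\<close> coordinates.\<close>
    have "(\<integral>\<omega>. F (B n \<omega>) \<partial>M) * (\<integral>\<omega>. G (B n \<omega>) \<partial>M)
        \<le> (\<integral>\<omega>. F (B n \<omega>) * G (B n \<omega>) \<partial>M)" for n
      unfolding B_def Z_def[abs_def]
    proof (rule finite_dimensional_comonotony[OF \<open>prob_space M\<close> markov monotony \<tau>_mono \<tau>_mem,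
          where f="\<lambda>z. F (bernstein_path T n z)" and g="\<lambda>z. G (bernstein_path T n z)" and c=c])
      show "mono (\<lambda>z. F (bernstein_path T n z))" "mono (\<lambda>z. G (bernstein_path T n z))"
        by (auto intro!: monoI mono bernstein_path_mono)
    qed (auto simp: bdd)
    then show "\<exists>N. \<forall>n\<ge>N. (\<integral>\<omega>. F (B n \<omega>) \<partial>M) * (\<integral>\<omega>. G (B n \<omega>) \<partial>M)
        \<le> (\<integral>\<omega>. F (B n \<omega>) * G (B n \<omega>) \<partial>M)"
      by blast
  qed
qed

text \<open>Bounded continuous functions on the line form a nonseparable space, whose Borel sets are
  not generated by evaluations. Measurability comes instead from the pointwise limit of the
  measurable Bernstein paths.\<close>

lemma borel_measurable_bcontfun_path:
  assumes T: "0 < T"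
    and cont: "\<And>\<omega>. \<omega> \<in> space M \<Longrightarrow> continuous_on {0..T} (\<lambda>t. X t \<omega>)"
    and X: "\<And>t. t \<in> {0..T} \<Longrightarrow> X t \<in> borel_measurable M"
  shows "bcontfun_path T X \<in> borel_measurable M"
proof (rule borel_measurable_LIMSEQ_metric)
  fix n :: nat
  have X': "X (T * min 1 (real i / real n)) \<in> borel_measurable M" for i
    using T by (intro X) (auto simp: mult_le_cancel_left1)
  have "(\<lambda>\<omega> i. if i < Suc n then X (T * min 1 (real i / real n)) \<omega> else 0) \<in> borel_measurable M"
    by (rule measurable_coordinatewise_then_product) (use X' in measurable)
  then show "(\<lambda>\<omega>. bernstein_path T n (\<lambda>i. if i < Suc n then X (T * min 1 (real i / real n)) \<omega> else 0))
      \<in> borel_measurable M"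
    by measurable
qed (rule bernstein_path_tendsto_bcontfun_path[OF T cont])

section \<open>Transfer to path space\<close>

text \<open>The set of continuity points has full measure under the path law, so almost every sample
  path lies in it. At such a path, neighbourhoods in path space pull back to open sets along
  restriction.\<close>

lemma AE_isCont_restrict:
  assumes "prob_space M" and T: "0 < T"
    and cont: "\<And>\<omega>. \<omega> \<in> space M \<Longrightarrow> continuous_on {0..T} (\<lambda>t. X t \<omega>)"
    and meas: "bcontfun_path T X \<in> borel_measurable M"
    and F: "as_continuous M T X F"
  shows "AE \<omega> in M. isCont (\<lambda>b. F (restrict (apply_bcontfun b) {0..T})) (bcontfun_path T X \<omega>)"
proof -
  interpret prob_space M by fact
  have path: "restrict (apply_bcontfun (bcontfun_path T X \<omega>)) {0..T} = sample_path T X \<omega>"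
    if "\<omega> \<in> space M" for \<omega>
    by (rule restrict_bcontfun_path[where X=X, OF T cont[OF that]])
  \<comment> \<open>On \<open>space M\<close> the sample path is the restriction of the measurable
    map \<open>bcontfun_path T X\<close>. This makes the path law a genuine image
    probability.\<close>
  have sp: "sample_path T X \<in> M \<rightarrow>\<^sub>M path_borel T"
    using measurable_compose[OF meas measurable_restrict_bcontfun[of T]]
    by (subst measurable_cong[OF path[symmetric]]) 
  interpret L: prob_space "path_law M T X"
    unfolding path_law_def by (rule prob_space_distr[OF sp])
  obtain A where A: "A \<in> sets (path_borel T)" "measure (path_law M T X) A = 1"
    and cF: "\<And>\<alpha>. \<alpha> \<in> A \<Longrightarrow> topcontinuous_at (path_topology T) euclidean F \<alpha>"
    using F unfolding as_continuous_def by blast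
  have "AE \<alpha> in path_law M T X. \<alpha> \<in> A"
    using A by (intro L.AE_prob_1)
  then have "AE \<omega> in M. sample_path T X \<omega> \<in> A"
    unfolding path_law_def using A(1) sets.sets_into_space[OF A(1)]
    by (subst (asm) AE_distr_iff[OF sp]) (auto simp: Collect_conj_eq Int_absorb1 Int_def[symmetric])
  then show ?thesis
  proof (rule AE_mp, intro AE_I2 impI)
    fix \<omega> assume \<omega>: "\<omega> \<in> space M" "sample_path T X \<omega> \<in> A"
    show "isCont (\<lambda>b. F (restrict (apply_bcontfun b) {0..T})) (bcontfun_path T X \<omega>)"
      unfolding continuous_at_open
    proof (intro allI impI, elim conjE)
      fix V :: "real set"
      assume V: "open V" "F (restrict (apply_bcontfun (bcontfun_path T X \<omega>)) {0..T}) \<in> V"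
      then obtain U where U: "openin (path_topology T) U" "sample_path T X \<omega> \<in> U"
        and UV: "\<And>\<alpha>. \<alpha> \<in> U \<Longrightarrow> F \<alpha> \<in> V"
        using cF[OF \<omega>(2)] path[OF \<omega>(1)] unfolding topcontinuous_at_def by auto
      show "\<exists>S. open S \<and> bcontfun_path T X \<omega> \<in> S \<and>
          (\<forall>b\<in>S. F (restrict (apply_bcontfun b) {0..T}) \<in> V)"
        using open_restrict_bcontfun[OF U(1)] U(2) UV path[OF \<omega>(1)]
        by (intro exI[of _ "{b. restrict (apply_bcontfun b) {0..T} \<in> U}"]) auto
    qed
  qed
qed

theorem proposition4p3:
  fixes M :: "'a measure" and T :: real and X :: "real \<Rightarrow> 'a \<Rightarrow> real"
    and P :: "real \<Rightarrow> real \<Rightarrow> real \<Rightarrow> real measure"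
  assumes "prob_space M"
    and "0 < T"
    and "\<And>\<omega>. \<omega> \<in> space M \<Longrightarrow> continuous_on {0..T} (\<lambda>t. X t \<omega>)"
    and "markov_process M T X P"
    and "\<And>s t. 0 \<le> s \<Longrightarrow> s \<le> t \<Longrightarrow> t \<le> T \<Longrightarrow> monotony_preserving (P s t)"
  shows "functional_comonotony_principle M T X"
  unfolding functional_comonotony_principle_def
proof (intro allI impI, elim conjE)
  fix F G :: "(real \<Rightarrow> real) \<Rightarrow> real"
  assume meas: "F \<in> borel_measurable (path_borel T)" "G \<in> borel_measurable (path_borel T)"
    and bdd: "bounded (F ` path_space T)" "bounded (G ` path_space T)"
    and co: "co_monotone T F G"
    and cont: "as_continuous M T X F" "as_continuous M T X G"
  \<comment> \<open>Composition with \<open>R\<close> transports the functionals to bounded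
    continuous functions, preserving measurability, order, bounds and almost sure
    continuity.\<close>
  define R where "R b = restrict (apply_bcontfun b) {0..T}" for b :: "real \<Rightarrow>\<^sub>C real"
  note comonotony = comonotony_bcontfun_path[OF assms]
  have Y_meas: "bcontfun_path T X \<in> borel_measurable M"
    using assms(4) by (intro borel_measurable_bcontfun_path assms) (auto simp: markov_process_def)
  have path: "sample_path T X \<omega> = R (bcontfun_path T X \<omega>)" if "\<omega> \<in> space M" for \<omega>
    unfolding R_def by (rule restrict_bcontfun_path[where X=X, OF assms(2) assms(3)[OF that], symmetric])
  have R_mem: "R b \<in> path_space T" for b
    unfolding R_def by (rule restrict_bcontfun_in_path_space)
  have R_le: "path_le T (R a) (R b)" if "\<And>t. apply_bcontfun a t \<le> apply_bcontfun b t" for a b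
    using that by (simp add: path_le_def R_def)
  have FR: "(\<lambda>b. F (R b)) \<in> borel_measurable borel" "(\<lambda>b. G (R b)) \<in> borel_measurable borel"
    unfolding R_def by (rule measurable_compose[OF measurable_restrict_bcontfun] meas)+
  obtain c1 c2 where "\<And>\<alpha>. \<alpha> \<in> path_space T \<Longrightarrow> \<bar>F \<alpha>\<bar> \<le> c1" "\<And>\<alpha>. \<alpha> \<in> path_space T \<Longrightarrow> \<bar>G \<alpha>\<bar> \<le> c2"
    using bdd unfolding bounded_iff by (metis imageI real_norm_def)
  then have c: "\<bar>F (R b)\<bar> \<le> max c1 c2" "\<bar>G (R b)\<bar> \<le> max c1 c2" for b
    using R_mem by (meson max.coboundedI1 max.coboundedI2)+
  have AE_cont: "AE \<omega> in M. isCont (\<lambda>b. F (R b)) (bcontfun_path T X \<omega>)"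
    "AE \<omega> in M. isCont (\<lambda>b. G (R b)) (bcontfun_path T X \<omega>)"
    unfolding R_def by (rule AE_isCont_restrict[OF assms(1-3) Y_meas] cont | assumption)+
  let ?Y = "bcontfun_path T X"
  have "(\<integral>\<omega>. F (R (?Y \<omega>)) \<partial>M) * (\<integral>\<omega>. G (R (?Y \<omega>)) \<partial>M) \<le> (\<integral>\<omega>. F (R (?Y \<omega>)) * G (R (?Y \<omega>)) \<partial>M)"
    using co unfolding co_monotone_def
  proof (elim disjE conjE)
    assume "monotone_on (path_space T) (path_le T) (\<le>) F" "monotone_on (path_space T) (path_le T) (\<le>) G"
    note this[THEN monotone_onD, OF R_mem R_mem R_le]
    then show ?thesis
      by (intro comonotony[where F="\<lambda>b. F (R b)" and G="\<lambda>b. G (R b)" and c="max c1 c2"] FR c AE_cont Y_meas) auto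
  next
    \<comment> \<open>For nonincreasing functionals the result is applied to \<open>- F\<close> and
      \<open>- G\<close>; the two signs cancel in each product.\<close>
    assume "monotone_on (path_space T) (path_le T) (\<ge>) F" "monotone_on (path_space T) (path_le T) (\<ge>) G"
    note this[THEN monotone_onD, OF R_mem R_mem R_le]
    moreover have "AE \<omega> in M. isCont (\<lambda>b. - F (R b)) (?Y \<omega>)"
      using AE_cont(1) by eventually_elim (rule isCont_minus)
    moreover have "AE \<omega> in M. isCont (\<lambda>b. - G (R b)) (?Y \<omega>)"
      using AE_cont(2) by eventually_elim (rule isCont_minus)
    ultimately have "(\<integral>\<omega>. - F (R (?Y \<omega>)) \<partial>M) * (\<integral>\<omega>. - G (R (?Y \<omega>)) \<partial>M)
        \<le> (\<integral>\<omega>. - F (R (?Y \<omega>)) * - G (R (?Y \<omega>)) \<partial>M)"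
      using FR c
      by (intro comonotony[where F="\<lambda>b. - F (R b)" and G="\<lambda>b. - G (R b)" and c="max c1 c2"] Y_meas) auto
    then show ?thesis by simp
  qed
  then show "(\<integral>\<omega>. F (sample_path T X \<omega>) \<partial>M) * (\<integral>\<omega>. G (sample_path T X \<omega>) \<partial>M)
      \<le> (\<integral>\<omega>. F (sample_path T X \<omega>) * G (sample_path T X \<omega>) \<partial>M)"
    by (simp add: path cong: Bochner_Integration.integral_cong)
qed

end
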